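(* Let $n\ge2$ be an integer, let $0<q<p<1$, let $F=\{f_k\}_{k=0}^{\binom n2}$ be a set of functions $f_k:\{0,1\}^k\to(0,1]$, and let $(\tau_{ij})_{i<j}$ be predecessor sets. Let $(Y^\ast,A)$ be generated by the Dynamic Stochastic Block Model with parameters $(p,q,F)$ on $n$ nodes with these predecessor sets. If $$\frac{(p-q)^2}{q(1-q)} \leq \frac{n-2}{n^2-n}\, \log 2,$$ then for every (possibly randomized) estimator $\hat Y$ of $Y^\ast$ based on $A$, i.e. every random $\hat Y\in\{+1,-1\}^n$ such that $Y^\ast\to A\to\hat Y$ is a Markov chain, we have $$\mathbb{P}(\hat Y\neq Y^\ast)\ \geq\ \frac12 .$$
   Context: Predecessor sets: for each pair $1\le i<j\le n$, $\tau_{ij}$ is a fixed set with $$\tau_{ij}\subseteq\{(k,l)\mid (k<l)\wedge (k<i\ \vee\ (k=i\wedge l<j))\},$$ i.e. a set of pairs preceding $(i,j)$ in lexicographic order, and $A_{\tau_{ij}}=\{A_{kl}\mid (k,l)\in\tau_{ij}\}$, regarded as a vector in $\{0,1\}^{|\tau_{ij}|}$ (entries listed in lexicographic order of the pairs). Dynamic Stochastic Block Model with parameters $(p,q,F)$: a random undirected graph on nodes $1,\dots,n$ with adjacency entries $A_{ij}\in\{0,1\}$, $i<j$. The true label vector $Y^\ast=(y^\ast_1,\dots,y^\ast_n)$ is uniform on $\{+1,-1\}^n$. Given $Y^\ast$, the entries $A_{ij}$ are generated sequentially in lexicographic order of $(i,j)$: conditionally on $Y^\ast$ and all previously generated entries,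 $A_{ij}$ is Bernoulli with parameter $p\,f_{|\tau_{ij}|}(A_{\tau_{ij}})$ if $y^\ast_i=y^\ast_j$, and Bernoulli with parameter $q\,f_{|\tau_{ij}|}(A_{\tau_{ij}})$ otherwise. Thus $P(A\mid Y)=\prod_{i<j}P(A_{ij}\mid A_{\tau_{ij}},y_i,y_j)$. $\log$ is the natural logarithm. The Markov chain condition means that $\hat Y$ is conditionally independent of $Y^\ast$ given $A$. *)

theory Defs
  imports "HOL-Probability.Probability"
begin

definition labelings :: "nat \<Rightarrow> (nat \<Rightarrow> int) set" where
  "labelings n = {1..n} \<rightarrow>\<^sub>E {1, -1}"

text \<open>The pairs \<open>1 \<le> i < j \<le> n\<close> in lexicographic order. (The library's lexicographic
  order instance on pairs clashes with the componentwise one used by \<open>HOL-Analysis\<close>.)\<close>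

definition lex_pairs :: "nat \<Rightarrow> (nat \<times> nat) list" where
  "lex_pairs n = [(i, j). i \<leftarrow> [1..<Suc n], j \<leftarrow> [Suc i..<Suc n]]"

text \<open>A graph is given by its adjacency entries \<open>a (i, j)\<close> with \<open>i < j\<close>, where \<open>True\<close> and
  \<open>False\<close> stand for \<open>1\<close> and \<open>0\<close>; all other arguments are mapped to \<open>False\<close>.\<close>

definition graphs :: "nat \<Rightarrow> (nat \<times> nat \<Rightarrow> bool) set" where
  "graphs n = {a. \<forall>e. a e \<longrightarrow> e \<in> set (lex_pairs n)}"

definition predecessor_sets :: "nat \<Rightarrow> (nat \<Rightarrow> nat \<Rightarrow> (nat \<times> nat) set) \<Rightarrow> bool" where
  "predecessor_sets n \<tau> \<longleftrightarrow>
     (\<forall>i j. 1 \<le> i \<and> i < j \<and> j \<le> n \<longrightarrow>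
        \<tau> i j \<subseteq> {(k, l). 1 \<le> k \<and> k < l \<and> l \<le> n \<and> (k < i \<or> (k = i \<and> l < j))})"

text \<open>A function on \<open>{0,1}\<^sup>k\<close> is represented by a function on lists, of which only the
  values on lists of length \<open>k\<close> matter.\<close>

definition influence_family :: "nat \<Rightarrow> (nat \<Rightarrow> bool list \<Rightarrow> real) \<Rightarrow> bool" where
  "influence_family n f \<longleftrightarrow>
     (\<forall>k \<le> n choose 2. \<forall>x. length x = k \<longrightarrow> 0 < f k x \<and> f k x \<le> 1)"

definition entries :: "nat \<Rightarrow> (nat \<times> nat \<Rightarrow> bool) \<Rightarrow> (nat \<times> nat) set \<Rightarrow> bool list" where
  "entries n a T = map a (filter (\<lambda>e. e \<in> T) (lex_pairs n))"

definition edge_prob ::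
  "nat \<Rightarrow> real \<Rightarrow> real \<Rightarrow> (nat \<Rightarrow> bool list \<Rightarrow> real) \<Rightarrow> (nat \<Rightarrow> nat \<Rightarrow> (nat \<times> nat) set) \<Rightarrow>
   (nat \<Rightarrow> int) \<Rightarrow> (nat \<times> nat \<Rightarrow> bool) \<Rightarrow> nat \<times> nat \<Rightarrow> real" where
  "edge_prob n p q f \<tau> y a = (\<lambda>(i, j).
     (if y i = y j then p else q) * f (card (\<tau> i j)) (entries n a (\<tau> i j)))"

text \<open>Generates the entries in the given list one after the other; \<open>r a e\<close> is the success
  probability of entry \<open>e\<close> when \<open>a\<close> holds the entries generated so far.\<close>

primrec generate_entries ::
  "((nat \<times> nat \<Rightarrow> bool) \<Rightarrow> nat \<times> nat \<Rightarrow> real) \<Rightarrow> (nat \<times> nat) list \<Rightarrow>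
   (nat \<times> nat \<Rightarrow> bool) \<Rightarrow> (nat \<times> nat \<Rightarrow> bool) pmf" where
  "generate_entries r [] a = return_pmf a"
| "generate_entries r (e # es) a =
     bernoulli_pmf (r a e) \<bind> (\<lambda>b. generate_entries r es (a(e := b)))"

definition dynamic_sbm ::
  "nat \<Rightarrow> real \<Rightarrow> real \<Rightarrow> (nat \<Rightarrow> bool list \<Rightarrow> real) \<Rightarrow> (nat \<Rightarrow> nat \<Rightarrow> (nat \<times> nat) set) \<Rightarrow>
   ((nat \<Rightarrow> int) \<times> (nat \<times> nat \<Rightarrow> bool)) pmf" where
  "dynamic_sbm n p q f \<tau> =
     pmf_of_set (labelings n) \<bind> (\<lambda>y.
     generate_entries (edge_prob n p q f \<tau> y) (lex_pairs n) (\<lambda>_. False) \<bind> (\<lambda>a.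
     return_pmf (y, a)))"

text \<open>\<open>X \<rightarrow> Y \<rightarrow> Z\<close> is a Markov chain, i.e. \<open>X\<close> and \<open>Z\<close> are conditionally independent given
  \<open>Y\<close>. This pointwise form is meant for random variables with finite range.\<close>

definition markov_chain ::
  "'w measure \<Rightarrow> ('w \<Rightarrow> 'a) \<Rightarrow> ('w \<Rightarrow> 'b) \<Rightarrow> ('w \<Rightarrow> 'c) \<Rightarrow> bool" where
  "markov_chain M X Y Z \<longleftrightarrow>
     (\<forall>x y z. \<P>(\<omega> in M. Y \<omega> = y) > 0 \<longrightarrow>
        \<P>(\<omega> in M. X \<omega> = x \<and> Z \<omega> = z \<bar> Y \<omega> = y) =
        \<P>(\<omega> in M. X \<omega> = x \<bar> Y \<omega> = y) * \<P>(\<omega> in M. Z \<omega> = z \<bar> Y \<omega> = y))"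

end

theory Submission imports Defs begin

text \<open>A second-moment (change of measure) argument replaces Fano's inequality. Compare the law
  \<open>P\<^sub>y\<close> of the graph given the labels \<open>y\<close> with the label-free law \<open>Q\<close> obtained from \<open>p := q\<close>. The
  conditional \<open>\<chi>\<^sup>2\<close>-divergence of each entry is at most \<open>\<delta> = (p - q)\<^sup>2 / (q (1 - q))\<close>, so with
  \<open>m = n choose 2\<close> one gets \<open>(\<integral> \<phi> dP\<^sub>y)\<^sup>2 \<le> (1 + \<delta>)\<^sup>m \<integral> \<phi>\<^sup>2 dQ\<close> for every \<open>\<phi>\<close>. Take for
  \<open>\<phi>\<^sub>y\<close> the conditional probability of guessing \<open>y\<close>; then \<open>t \<le> 1/4 + t\<^sup>2\<close> and \<open>\<Sum>\<^sub>y \<phi>\<^sub>y \<le> 1\<close> bound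
  the success probability by \<open>1/4 + 2^(-n) (1 + \<delta>)\<^sup>m\<close>, and the hypothesis gives
  \<open>(1 + \<delta>)\<^sup>m \<le> 2^(n - 2)\<close>.\<close>

section \<open>Second moments under a change of measure\<close>

lemma bernoulli_second_moment:
  fixes x y u v \<delta> :: real
  assumes "0 < \<delta>" "(x - y)\<^sup>2 \<le> \<delta> * (y * (1 - y))"
  shows "(x * u + (1 - x) * v)\<^sup>2 \<le> (1 + \<delta>) * (y * u\<^sup>2 + (1 - y) * v\<^sup>2)"
proof -
  \<comment> \<open>For a variable with the values \<open>u\<close> and \<open>v\<close>,
    \<open>m\<close> is its mean under the Bernoulli parameter \<open>y\<close>, and
    \<open>w\<close> is the shift of the mean when the parameter becomes \<open>x\<close>. The
    hypothesis says that \<open>w\<close> squared is at most \<delta> times the variance.\<close>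
  define m where "m = y * u + (1 - y) * v"
  define w where "w = (x - y) * (u - v)"
  have w: "w\<^sup>2 \<le> \<delta> * (y * (1 - y) * (u - v)\<^sup>2)"
    using mult_right_mono[OF assms(2), of "(u - v)\<^sup>2"]
    by (simp add: w_def power_mult_distrib mult.assoc)
  \<comment> \<open>Weighted AM-GM for the cross term: \<open>2 * m * w\<close> costs \<delta> times
    the squared mean plus \<open>w\<close> squared over \<delta>, and the latter is at most the
    variance.\<close>
  have "0 \<le> (\<delta> * m - w)\<^sup>2" by simp
  then have "\<delta> * (2 * m * w) \<le> \<delta> * (\<delta> * m\<^sup>2) + w\<^sup>2"
    by (simp add: power2_eq_square algebra_simps)
  also have "\<dots> \<le> \<delta> * (\<delta> * m\<^sup>2 + y * (1 - y) * (u - v)\<^sup>2)"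
    using w by (simp add: distrib_left)
  finally have "2 * m * w \<le> \<delta> * m\<^sup>2 + y * (1 - y) * (u - v)\<^sup>2"
    using assms(1) by simp
  then have "(m + w)\<^sup>2 \<le> (1 + \<delta>) * (m\<^sup>2 + y * (1 - y) * (u - v)\<^sup>2)"
    using w by (simp add: power2_sum algebra_simps)
  moreover have "x * u + (1 - x) * v = m + w"
    by (simp add: m_def w_def algebra_simps)
  moreover have "y * u\<^sup>2 + (1 - y) * v\<^sup>2 = m\<^sup>2 + y * (1 - y) * (u - v)\<^sup>2"
    by (simp add: m_def power2_eq_square algebra_simps)
  ultimately show ?thesis by simp
qed

lemma set_generate_entries:
  "x \<in> set_pmf (generate_entries r es a) \<Longrightarrow> x e \<Longrightarrow> a e \<or> e \<in> set es"
  by (induction es arbitrary: a) (auto split: if_split_asm, metis fun_upd_other)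

lemma finite_set_generate_entries: "finite (set_pmf (generate_entries r es a))"
  by (induction es arbitrary: a) auto

lemma expectation_generate_Cons:
  fixes \<phi> :: "(nat \<times> nat \<Rightarrow> bool) \<Rightarrow> real"
  assumes "0 \<le> r a e" "r a e \<le> 1"
  shows "measure_pmf.expectation (generate_entries r (e # es) a) \<phi> =
    r a e * measure_pmf.expectation (generate_entries r es (a(e := True))) \<phi>
    + (1 - r a e) * measure_pmf.expectation (generate_entries r es (a(e := False))) \<phi>"
proof -
  have "measure_pmf.expectation (generate_entries r (e # es) a) \<phi> =
    (\<Sum>b\<in>UNIV. pmf (bernoulli_pmf (r a e)) b *\<^sub>R
      measure_pmf.expectation (generate_entries r es (a(e := b))) \<phi>)"
    unfolding generate_entries.simps
    by (rule pmf_expectation_bind) (auto intro: finite_set_generate_entries)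
  then show ?thesis using assms by (simp add: UNIV_bool)
qed

text \<open>The entries may depend on each other, but the one-step bound is uniform in the history
  \<open>a\<close>, so every generated entry costs one factor \<open>1 + \<delta>\<close>.\<close>

lemma generate_entries_second_moment:
  fixes \<phi> :: "(nat \<times> nat \<Rightarrow> bool) \<Rightarrow> real"
  assumes "0 < \<delta>"
    and "\<And>a e. e \<in> set es \<Longrightarrow> 0 \<le> r a e \<and> r a e \<le> 1 \<and> 0 \<le> s a e \<and> s a e \<le> 1
           \<and> (r a e - s a e)\<^sup>2 \<le> \<delta> * (s a e * (1 - s a e))"
  shows "(measure_pmf.expectation (generate_entries r es a) \<phi>)\<^sup>2
    \<le> (1 + \<delta>) ^ length es * measure_pmf.expectation (generate_entries s es a) (\<lambda>x. (\<phi> x)\<^sup>2)"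
  using assms(2)
proof (induction es arbitrary: a)
  case Nil
  show ?case by simp
next
  case (Cons e es)
  let ?P = "\<lambda>b. measure_pmf.expectation (generate_entries r es (a(e := b))) \<phi>"
  let ?Q = "\<lambda>b. measure_pmf.expectation (generate_entries s es (a(e := b))) (\<lambda>x. (\<phi> x)\<^sup>2)"
  have re: "0 \<le> r a e" "r a e \<le> 1" "0 \<le> s a e" "s a e \<le> 1"
    "(r a e - s a e)\<^sup>2 \<le> \<delta> * (s a e * (1 - s a e))"
    using Cons.prems[of e a] by auto
  have IH: "(?P b)\<^sup>2 \<le> (1 + \<delta>) ^ length es * ?Q b" for b
    using Cons by simp
  \<comment> \<open>Conditioning on the first entry: \<open>u\<close> and \<open>v\<close> are the
    conditional expectations of \<phi> under \<open>r\<close>, whose squares the induction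
    hypothesis then compares with \<open>s\<close>.\<close>
  have "(r a e * ?P True + (1 - r a e) * ?P False)\<^sup>2
      \<le> (1 + \<delta>) * (s a e * (?P True)\<^sup>2 + (1 - s a e) * (?P False)\<^sup>2)"
    using assms(1) re by (intro bernoulli_second_moment)
  also have "\<dots> \<le> (1 + \<delta>) * (s a e * ((1 + \<delta>) ^ length es * ?Q True)
      + (1 - s a e) * ((1 + \<delta>) ^ length es * ?Q False))"
    using assms(1) re IH by (intro mult_left_mono add_mono) auto
  also have "\<dots> = (1 + \<delta>) ^ length (e # es) * (s a e * ?Q True + (1 - s a e) * ?Q False)"
    by (simp add: algebra_simps)
  finally show ?case
    using re by (simp only: expectation_generate_Cons)
qed

section \<open>Counting pairs, graphs and labelings\<close>

lemma set_lex_pairs: "set (lex_pairs n) = {(i, j). 1 \<le> i \<and> i < j \<and> j \<le> n}"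
  by (force simp: lex_pairs_def simp del: upt_Suc)

lemma distinct_lex_pairs: "distinct (lex_pairs n)"
proof -
  \<comment> \<open>The outer range is generalised to an arbitrary distinct list to permit
    induction; the bound \<open>n\<close> of the inner range stays fixed.\<close>
  have "distinct [(i, j). i \<leftarrow> xs, j \<leftarrow> [Suc i..<Suc n]]" if "distinct xs" for xs
    using that by (induction xs) (auto simp: distinct_map inj_on_def)
  then show ?thesis by (simp add: lex_pairs_def)
qed

lemma length_lex_pairs: "length (lex_pairs n) = n choose 2"
proof -
  have "length (lex_pairs n) = (\<Sum>i\<leftarrow>[1..<Suc n]. n - i)"
    by (simp add: lex_pairs_def length_concat comp_def del: upt_Suc)
  also have "\<dots> = (\<Sum>i = 1..<Suc n. n - i)"
    by (simp only: interv_sum_list_conv_sum_set_nat set_upt)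
  also have "\<dots> = (\<Sum>i<n. i)"
    by (rule sum.reindex_bij_witness[of _ "\<lambda>i. n - i" "\<lambda>i. n - i"]) auto
  also have "\<dots> = n choose 2"
    by (induction n) (auto simp: numeral_2_eq_2)
  finally show ?thesis .
qed

lemma finite_graphs: "finite (graphs n)"
proof -
  have "graphs n \<subseteq> (\<lambda>S e. e \<in> S) ` Pow (set (lex_pairs n))"
  proof
    fix a assume "a \<in> graphs n"
    then show "a \<in> (\<lambda>S e. e \<in> S) ` Pow (set (lex_pairs n))"
      by (intro image_eqI[of _ _ "Collect a"]) (auto simp: graphs_def)
  qed
  then show ?thesis by (rule finite_subset) simp
qed

lemma finite_labelings: "finite (labelings n)"
  by (simp add: labelings_def finite_PiE)

lemma card_labelings: "card (labelings n) = 2 ^ n"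
  by (simp add: labelings_def card_PiE numeral_2_eq_2)

lemma labelings_nonempty: "labelings n \<noteq> {}"
  using card_labelings[of n] by auto

text \<open>Makes the bounds in \<open>influence_family\<close>, which concern lists of length
  \<open>k\<close> only, applicable with \<open>k = card T\<close>.\<close>

lemma length_entries:
  assumes "T \<subseteq> set (lex_pairs n)"
  shows "length (entries n a T) = card T"
proof -
  have "length (entries n a T) = card (set (filter (\<lambda>e. e \<in> T) (lex_pairs n)))"
    by (simp add: entries_def distinct_card distinct_lex_pairs del: set_filter)
  also have "set (filter (\<lambda>e. e \<in> T) (lex_pairs n)) = T"
    using assms by auto
  finally show ?thesis .
qed

section \<open>Edge probabilities and the law of the model\<close>

lemma influence_bounds:
  assumes "influence_family n f" "predecessor_sets n \<tau>" "(i, j) \<in> set (lex_pairs n)"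
  shows "0 < f (card (\<tau> i j)) (entries n a (\<tau> i j))"
    and "f (card (\<tau> i j)) (entries n a (\<tau> i j)) \<le> 1"
proof -
  have "\<tau> i j \<subseteq> set (lex_pairs n)"
    using assms(2,3) unfolding predecessor_sets_def set_lex_pairs by fast
  moreover from this have "card (\<tau> i j) \<le> n choose 2"
    using card_mono[of "set (lex_pairs n)"]
    by (simp add: distinct_card distinct_lex_pairs length_lex_pairs)
  ultimately show "0 < f (card (\<tau> i j)) (entries n a (\<tau> i j))"
    "f (card (\<tau> i j)) (entries n a (\<tau> i j)) \<le> 1"
    using assms(1) by (auto simp: influence_family_def length_entries)
qed

text \<open>Damping both parameters by \<open>g\<close> does not increase the divergence, because
  \<open>g * (1 - q) \<le> 1 - q * g\<close> when \<open>g \<le> 1\<close>. Hence one \<delta>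
  serves for all histories.\<close>

lemma scaled_bernoulli_chi_square:
  fixes p q g :: real
  assumes "0 < q" "q < 1" "0 < g" "g \<le> 1"
  shows "(p * g - q * g)\<^sup>2 \<le> (p - q)\<^sup>2 / (q * (1 - q)) * (q * g * (1 - q * g))"
proof -
  have "q * (1 - q) * (p * g - q * g)\<^sup>2 = (p - q)\<^sup>2 * (q * g * (g * (1 - q)))"
    by (simp add: power2_eq_square algebra_simps)
  also have "\<dots> \<le> (p - q)\<^sup>2 * (q * g * (1 - q * g))"
    using assms by (intro mult_left_mono) (auto simp: algebra_simps)
  finally show ?thesis
    using assms by (simp add: pos_le_divide_eq mult.commute)
qed

lemma edge_prob_chi_square:
  assumes "0 < q" "q < p" "p < 1" "influence_family n f" "predecessor_sets n \<tau>"
    and "e \<in> set (lex_pairs n)"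
  shows "0 \<le> edge_prob n p q f \<tau> y a e \<and> edge_prob n p q f \<tau> y a e \<le> 1
    \<and> 0 \<le> edge_prob n q q f \<tau> z a e \<and> edge_prob n q q f \<tau> z a e \<le> 1
    \<and> (edge_prob n p q f \<tau> y a e - edge_prob n q q f \<tau> z a e)\<^sup>2
      \<le> (p - q)\<^sup>2 / (q * (1 - q)) *
        (edge_prob n q q f \<tau> z a e * (1 - edge_prob n q q f \<tau> z a e))"
proof -
  obtain i j where e: "e = (i, j)" by force
  define g where "g = f (card (\<tau> i j)) (entries n a (\<tau> i j))"
  have g: "0 < g" "g \<le> 1"
    using influence_bounds[OF assms(4,5)] assms(6) by (auto simp: g_def e)
  have "p * g \<le> 1" "q * g \<le> 1"
    using mult_mono[of p 1 g 1] mult_mono[of q 1 g 1] assms g by auto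
  then show ?thesis
    using scaled_bernoulli_chi_square[of q g p] assms(1-3) g
    by (simp add: edge_prob_def e flip: g_def)
qed

lemma pmf_dynamic_sbm:
  assumes "y \<in> labelings n"
  shows "pmf (dynamic_sbm n p q f \<tau>) (y, a) =
    pmf (generate_entries (edge_prob n p q f \<tau> y) (lex_pairs n) (\<lambda>_. False)) a / 2 ^ n"
proof -
  let ?G = "\<lambda>y. generate_entries (edge_prob n p q f \<tau> y) (lex_pairs n) (\<lambda>_. False)"
  have D: "dynamic_sbm n p q f \<tau> = pmf_of_set (labelings n) \<bind> (\<lambda>y. map_pmf (Pair y) (?G y))"
    by (simp add: dynamic_sbm_def map_pmf_def)
  have G: "pmf (map_pmf (Pair z) (?G z)) (y, a) = (if z = y then pmf (?G y) a else 0)" for z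
    by (auto simp: pmf_map_inj' inj_on_def pmf_eq_0_set_pmf)
  show ?thesis
    unfolding D pmf_bind G
    using assms finite_labelings labelings_nonempty
    by (simp add: integral_pmf_of_set card_labelings)
qed

section \<open>The success probability of an estimator\<close>

theorem theorem3:
  fixes n :: nat and p q :: real
    and f :: "nat \<Rightarrow> bool list \<Rightarrow> real"
    and \<tau> :: "nat \<Rightarrow> nat \<Rightarrow> (nat \<times> nat) set"
    and M :: "'w measure"
    and Y Yhat :: "'w \<Rightarrow> nat \<Rightarrow> int"
    and A :: "'w \<Rightarrow> nat \<times> nat \<Rightarrow> bool"
  assumes "n \<ge> 2"
    and "0 < q" and "q < p" and "p < 1"
    and "influence_family n f"
    and "predecessor_sets n \<tau>"
    and "prob_space M"
    and "Y \<in> measurable M (count_space (labelings n))"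
    and "A \<in> measurable M (count_space (graphs n))"
    and "distr M (count_space UNIV) (\<lambda>\<omega>. (Y \<omega>, A \<omega>)) = measure_pmf (dynamic_sbm n p q f \<tau>)"
    and "(p - q)\<^sup>2 / (q * (1 - q)) \<le> (real n - 2) / ((real n)\<^sup>2 - real n) * ln 2"
    and "Yhat \<in> measurable M (count_space (labelings n))"
    and "markov_chain M Y A Yhat"
  shows "\<P>(\<omega> in M. Yhat \<omega> \<noteq> Y \<omega>) \<ge> 1 / 2"
proof -
  interpret prob_space M by fact
  let ?L = "labelings n" and ?G = "graphs n"
  define \<delta> where "\<delta> = (p - q)\<^sup>2 / (q * (1 - q))"
  define P where "P y = generate_entries (edge_prob n p q f \<tau> y) (lex_pairs n) (\<lambda>_. False)" for y
  \<comment> \<open>With both parameters equal to \<open>q\<close> the labels drop out, so the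
    constant 0 is a mere placeholder and not a labeling.\<close>
  define Q where "Q = generate_entries (edge_prob n q q f \<tau> (\<lambda>_. 0)) (lex_pairs n) (\<lambda>_. False)"
  \<comment> \<open>If \<open>A \<omega> = a\<close> has probability zero, division by zero makes
    this value 0, so the bounds on \<phi> below hold for every \<open>a\<close>.\<close>
  define \<phi> where "\<phi> y a = \<P>(\<omega> in M. Yhat \<omega> = y \<bar> A \<omega> = a)" for y a
  have \<delta>: "0 < \<delta>" using assms(2-4) by (simp add: \<delta>_def)

  have ran: "Y \<omega> \<in> ?L" "A \<omega> \<in> ?G" "Yhat \<omega> \<in> ?L" if "\<omega> \<in> space M" for \<omega>
    using that assms(8,9,12) by (auto dest: measurable_space)
  have ev: "{\<omega>\<in>space M. Y \<omega> = y} \<in> events" "{\<omega>\<in>space M. A \<omega> = a} \<in> events"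
    "{\<omega>\<in>space M. Yhat \<omega> = y} \<in> events" for y a
  proof -
    have *: "{\<omega>\<in>space M. X \<omega> = x} \<in> events" if "X \<in> measurable M (count_space S)"
      for X :: "'w \<Rightarrow> 'z" and S x
    proof -
      have "{\<omega>\<in>space M. X \<omega> = x} = X -` ({x} \<inter> S) \<inter> space M"
        using measurable_space[OF that] by auto
      also have "\<dots> \<in> events" using that by (rule measurable_sets) simp
      finally show ?thesis .
    qed
    show "{\<omega>\<in>space M. Y \<omega> = y} \<in> events" "{\<omega>\<in>space M. A \<omega> = a} \<in> events"
      "{\<omega>\<in>space M. Yhat \<omega> = y} \<in> events"
      by (fact *[OF assms(8)] *[OF assms(9)] *[OF assms(12)])+
  qed
  have ev2: "{\<omega>\<in>space M. Y \<omega> = y \<and> A \<omega> = a} \<in> events"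
    "{\<omega>\<in>space M. Y \<omega> = y \<and> Yhat \<omega> = z \<and> A \<omega> = a} \<in> events"
    "{\<omega>\<in>space M. Yhat \<omega> = z \<and> A \<omega> = a} \<in> events" for y z a
    using ev by (auto intro!: sets.sets_Collect_conj)

  \<comment> \<open>Needed to read off point masses from the joint law: the pair takes finitely many
    values, so each preimage is a finite union of events.\<close>
  have YA: "(\<lambda>\<omega>. (Y \<omega>, A \<omega>)) \<in> measurable M (count_space UNIV)"
  proof (rule measurableI)
    fix S :: "((nat \<Rightarrow> int) \<times> (nat \<times> nat \<Rightarrow> bool)) set"
    have "(\<lambda>\<omega>. (Y \<omega>, A \<omega>)) -` S \<inter> space M
        = (\<Union>(y, a)\<in>(?L \<times> ?G) \<inter> S. {\<omega>\<in>space M. Y \<omega> = y \<and> A \<omega> = a})"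
      using ran by auto
    also have "\<dots> \<in> events"
      using ev2 finite_labelings finite_graphs by (intro sets.finite_UN) auto
    finally show "(\<lambda>\<omega>. (Y \<omega>, A \<omega>)) -` S \<inter> space M \<in> events" .
  qed simp
  have joint: "\<P>(\<omega> in M. Y \<omega> = y \<and> A \<omega> = a) = pmf (P y) a / 2 ^ n" if "y \<in> ?L" for y a
  proof -
    have "\<P>(\<omega> in M. Y \<omega> = y \<and> A \<omega> = a) = measure (distr M (count_space UNIV) (\<lambda>\<omega>. (Y \<omega>, A \<omega>))) {(y, a)}"
      using YA by (subst measure_distr) (auto intro!: arg_cong[where f = prob])
    also have "\<dots> = pmf (dynamic_sbm n p q f \<tau>) (y, a)"
      by (simp add: assms(10) pmf.rep_eq)
    finally show ?thesis using that by (simp add: pmf_dynamic_sbm P_def)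
  qed
  \<comment> \<open>The Markov condition is instantiated at a correct guess. It covers only graphs
    of positive probability; for the others both sides vanish.\<close>
  have markov: "\<P>(\<omega> in M. Y \<omega> = y \<and> Yhat \<omega> = y \<and> A \<omega> = a) = \<P>(\<omega> in M. Y \<omega> = y \<and> A \<omega> = a) * \<phi> y a"
    for y a
  proof (cases "\<P>(\<omega> in M. A \<omega> = a) > 0")
    case True
    then have "\<P>(\<omega> in M. Y \<omega> = y \<and> Yhat \<omega> = y \<bar> A \<omega> = a)
        = \<P>(\<omega> in M. Y \<omega> = y \<bar> A \<omega> = a) * \<phi> y a"
      using assms(13) unfolding markov_chain_def \<phi>_def by blast
    then show ?thesis
      using True by (simp add: cond_prob_def conj_assoc)
  next
    case False
    then have 0: "\<P>(\<omega> in M. A \<omega> = a) = 0"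
      by (simp add: not_less measure_le_0_iff)
    have null: "prob S = 0" if "S \<subseteq> {\<omega>\<in>space M. A \<omega> = a}" for S
      using finite_measure_mono[OF that ev(2)] 0 by (simp add: measure_le_0_iff)
    have "\<P>(\<omega> in M. Y \<omega> = y \<and> Yhat \<omega> = y \<and> A \<omega> = a) = 0"
      "\<P>(\<omega> in M. Y \<omega> = y \<and> A \<omega> = a) = 0"
      by (rule null, blast)+
    then show ?thesis by simp
  qed

  have \<phi>_bounds: "0 \<le> \<phi> y a" "\<phi> y a \<le> 1" for y a
    using finite_measure_mono[OF _ ev(2), of "{\<omega>\<in>space M. Yhat \<omega> = y \<and> A \<omega> = a}" a]
    by (auto simp: \<phi>_def cond_prob_def divide_le_eq_1 Collect_mono zero_less_measure_iff
        less_le split: if_splits)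
  have \<phi>_sum: "(\<Sum>y\<in>?L. \<phi> y a) \<le> 1" for a
  proof -
    have "(\<Sum>y\<in>?L. \<P>(\<omega> in M. Yhat \<omega> = y \<and> A \<omega> = a)) = prob (\<Union>y\<in>?L. {\<omega>\<in>space M. Yhat \<omega> = y \<and> A \<omega> = a})"
      using ev2 finite_labelings
      by (intro finite_measure_finite_Union[symmetric]) (auto simp: disjoint_family_on_def)
    also have "\<dots> \<le> \<P>(\<omega> in M. A \<omega> = a)"
      using ev by (intro finite_measure_mono) auto
    finally have "(\<Sum>y\<in>?L. \<P>(\<omega> in M. Yhat \<omega> = y \<and> A \<omega> = a)) \<le> \<P>(\<omega> in M. A \<omega> = a)" .
    then show ?thesis
      by (auto simp: \<phi>_def cond_prob_def sum_divide_distrib[symmetric] divide_le_eq_1 less_le)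
  qed

  have success: "\<P>(\<omega> in M. Yhat \<omega> = Y \<omega>) = (\<Sum>y\<in>?L. measure_pmf.expectation (P y) (\<phi> y)) / 2 ^ n"
  proof -
    have "{\<omega>\<in>space M. Yhat \<omega> = Y \<omega>} =
        (\<Union>(y, a)\<in>?L \<times> ?G. {\<omega>\<in>space M. Y \<omega> = y \<and> Yhat \<omega> = y \<and> A \<omega> = a})"
      using ran by auto
    then have "\<P>(\<omega> in M. Yhat \<omega> = Y \<omega>) = prob \<dots>" by (rule arg_cong)
    also have "\<dots> = (\<Sum>(y, a)\<in>?L \<times> ?G. \<P>(\<omega> in M. Y \<omega> = y \<and> Yhat \<omega> = y \<and> A \<omega> = a))"
      using ev2 finite_labelings finite_graphs
      by (subst finite_measure_finite_Union)
         (auto simp: disjoint_family_on_def case_prod_unfold)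
    also have "\<dots> = (\<Sum>y\<in>?L. \<Sum>a\<in>?G. pmf (P y) a / 2 ^ n * \<phi> y a)"
      by (simp add: sum.cartesian_product[symmetric] markov joint)
    also have "\<dots> = (\<Sum>y\<in>?L. measure_pmf.expectation (P y) (\<phi> y) / 2 ^ n)"
    proof (rule sum.cong)
      fix y
      have "set_pmf (P y) \<subseteq> ?G"
        by (auto simp: P_def graphs_def dest: set_generate_entries)
      then have "measure_pmf.expectation (P y) (\<phi> y) = (\<Sum>a\<in>?G. pmf (P y) a * \<phi> y a)"
        using finite_graphs by (subst integral_measure_pmf[of ?G]) auto
      then show "(\<Sum>a\<in>?G. pmf (P y) a / 2 ^ n * \<phi> y a) = measure_pmf.expectation (P y) (\<phi> y) / 2 ^ n"
        by (simp add: sum_divide_distrib)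
    qed simp
    finally show ?thesis by (simp add: sum_divide_distrib)
  qed

  have fin: "finite (set_pmf Q)"
    unfolding Q_def by (rule finite_set_generate_entries)
  have int: "integrable (measure_pmf Q) h" for h :: "_ \<Rightarrow> real"
    using fin by (rule integrable_measure_pmf_finite)
  define X where "X = (1 + \<delta>) ^ length (lex_pairs n)"
  have X: "0 \<le> X" using \<delta> by (simp add: X_def)
  have bound: "measure_pmf.expectation (P y) (\<phi> y) \<le> 1 / 4 + X * measure_pmf.expectation Q (\<phi> y)" for y
  proof -
    define m where "m = measure_pmf.expectation (P y) (\<phi> y)"
    \<comment> \<open>Tangent of the square at 1/2. Its constant 1/4 uses up half of the allowed
      success probability 1/2 and leaves 1/4 for the term with \<open>X\<close>.\<close>
    have "0 \<le> (m - 1 / 2)\<^sup>2" by simp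
    then have "m \<le> 1 / 4 + m\<^sup>2" by (simp add: power2_eq_square algebra_simps)
    also have "m\<^sup>2 \<le> X * measure_pmf.expectation Q (\<lambda>a. (\<phi> y a)\<^sup>2)"
      unfolding m_def X_def P_def Q_def using \<delta> edge_prob_chi_square[OF assms(2-6)]
      by (intro generate_entries_second_moment) (auto simp: \<delta>_def)
    \<comment> \<open>Since \<phi> lies between 0 and 1, its square is at most \<phi>. The bound
      becomes linear in \<phi>, and as \<open>Q\<close> is the same for all \<open>y\<close>,
      summing over \<open>y\<close> can use \<open>\<phi>_sum\<close>.\<close>
    also have "\<dots> \<le> X * measure_pmf.expectation Q (\<phi> y)"
      using X \<phi>_bounds int
      by (intro mult_left_mono integral_mono) (auto simp: power2_eq_square mult_left_le)
    finally show ?thesis by (simp add: m_def)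
  qed
  have "(\<Sum>y\<in>?L. measure_pmf.expectation (P y) (\<phi> y))
      \<le> (\<Sum>y\<in>?L. 1 / 4 + X * measure_pmf.expectation Q (\<phi> y))"
    using bound by (rule sum_mono)
  also have "\<dots> = 2 ^ n / 4 + X * measure_pmf.expectation Q (\<lambda>a. \<Sum>y\<in>?L. \<phi> y a)"
    using int by (simp add: sum.distrib card_labelings sum_distrib_left[symmetric])
  also have "\<dots> \<le> 2 ^ n / 4 + X"
  proof -
    have "measure_pmf.expectation Q (\<lambda>a. \<Sum>y\<in>?L. \<phi> y a) \<le> 1"
      using \<phi>_sum int by (intro measure_pmf.integral_le_const) auto
    then show ?thesis using X by (simp add: mult_left_le)
  qed
  also have "X \<le> 2 ^ n / 4"
  proof -
    have n: "real (length (lex_pairs n)) = ((real n)\<^sup>2 - real n) / 2" "0 < (real n)\<^sup>2 - real n"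
    proof -
      have "real (n choose 2) = ((real n)\<^sup>2 - real n) / 2"
        using assms(1)
        by (simp add: choose_two real_of_nat_div of_nat_diff power2_eq_square algebra_simps)
      then show "real (length (lex_pairs n)) = ((real n)\<^sup>2 - real n) / 2"
        by (simp add: length_lex_pairs)
      show "0 < (real n)\<^sup>2 - real n"
        using assms(1) by (simp add: power2_eq_square)
    qed
    have "X \<le> exp \<delta> ^ length (lex_pairs n)"
      unfolding X_def using \<delta> by (intro power_mono) (auto simp: exp_ge_add_one_self)
    also have "\<dots> = exp (((real n)\<^sup>2 - real n) / 2 * \<delta>)"
      by (simp add: n(1) flip: exp_of_nat_mult)
    also have "\<dots> \<le> exp (real (n - 2) * ln 2)"
    proof -
      \<comment> \<open>The hypothesis bounds twice the exponent; as the exponent is nonnegative, it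
        obeys the same bound.\<close>
      have "((real n)\<^sup>2 - real n) * \<delta> \<le> real (n - 2) * ln 2"
        using assms(11)[folded \<delta>_def] assms(1) n(2)
        by (simp add: pos_le_divide_eq of_nat_diff mult.commute)
      moreover have "0 \<le> ((real n)\<^sup>2 - real n) * \<delta>" using n(2) \<delta> by simp
      ultimately show ?thesis by simp
    qed
    also have "\<dots> = 2 ^ (n - 2)" by (simp add: exp_of_nat_mult)
    also have "\<dots> = (2 ^ n / 4 :: real)" using assms(1) by (simp add: power_diff)
    finally show ?thesis .
  qed
  finally have "\<P>(\<omega> in M. Yhat \<omega> = Y \<omega>) \<le> 1 / 2"
    by (simp add: success field_simps)
  moreover have "\<P>(\<omega> in M. Yhat \<omega> \<noteq> Y \<omega>) = 1 - \<P>(\<omega> in M. Yhat \<omega> = Y \<omega>)"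
  proof (rule prob_neg)
    have "{\<omega>\<in>space M. Yhat \<omega> = Y \<omega>} = (\<Union>y\<in>?L. {\<omega>\<in>space M. Y \<omega> = y} \<inter> {\<omega>\<in>space M. Yhat \<omega> = y})"
      using ran by auto
    also have "\<dots> \<in> events"
      using ev finite_labelings by (intro sets.finite_UN) auto
    finally show "{\<omega>\<in>space M. Yhat \<omega> = Y \<omega>} \<in> events" .
  qed
  ultimately show ?thesis by simp
qed

end
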